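(* Let $x, y \in \mathbb{N}$ with $x > y \geq 0$. Then the number $m$ of (recursive) iterations performed by the Euclidean Algorithm on input $(x,y)$ satisfies $$m \leq \log_{1.5}(x+y) + 1.$$
   Context: Here $\mathbb{N}$ denotes the non-negative integers. The Euclidean Algorithm takes as input two non-negative integers $x > y$ and computes $\gcd(x,y)$ as follows: if $y = 0$, return $x$; if $y = 1$, return $1$; otherwise recursively return $\gcd(y, x \bmod y)$, where $x \bmod y \in \{0,\dots,y-1\}$ is the remainder of $x$ on division by $y$. The number $m$ of iterations is the total number of calls, including the initial call and the final call that returns without recursing. Equivalently: set $x_1 = x$, $y_1 = y$, and as long as $y_i \geq 2$ set $x_{i+1} = y_i$, $y_{i+1} = x_i \bmod y_i$; then $m$ is the index $i \ge 1$ at which $y_i \in \{0,1\}$ first occurs. *)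

theory Defs
  imports Complex_Main
begin

text \<open>
  The Euclidean Algorithm, instrumented: the first component is the returned value, the second
  is the number of calls, counting both the initial call and the final, non-recursive one.
\<close>

fun euclid :: "nat \<Rightarrow> nat \<Rightarrow> nat \<times> nat" where
  "euclid x y =
     (if y = 0 then (x, 1)
      else if y = 1 then (1, 1)
      else (case euclid y (x mod y) of (d, m) \<Rightarrow> (d, m + 1)))"

(* The unconditional equation would loop as a rewrite rule. *)
declare euclid.simps [simp del]

definition euclid_iterations :: "nat \<Rightarrow> nat \<Rightarrow> nat" where
  "euclid_iterations x y = snd (euclid x y)"

lemma fst_euclid: "fst (euclid x y) = gcd x y"
proof (induction x y rule: euclid.induct)
  case (1 x y)
  then show ?case
    by (subst euclid.simps) (auto simp: case_prod_beta gcd_red_nat [of x y])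
qed

lemma euclid_iterations_rec:
  "euclid_iterations x y =
     (if y \<le> 1 then 1 else euclid_iterations y (x mod y) + 1)"
  unfolding euclid_iterations_def
  by (subst euclid.simps) (auto simp: case_prod_beta)

end

(* With r = x mod y we have x + y \<ge> 2 * y + r \<ge> 3/2 * (y + r), since x \<ge> y + r and r < y:
   every recursive call shrinks the sum of the arguments by a factor of at least 3/2, while
   the sum never drops below 1. *)
theory Submission
  imports Defs
begin

lemma sum_mod_le:
  fixes x y :: nat
  assumes "y > 0" and "y \<le> x"
  shows "3 / 2 * real (y + x mod y) \<le> real (x + y)"
proof -
  have "y * 1 \<le> y * (x div y)"
    using assms by (intro mult_le_mono2) (simp add: Suc_le_eq div_greater_zero_iff)
  then have "y + x mod y \<le> x"
    using mult_div_mod_eq [of y x] by linarith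
  moreover have "x mod y < y"
    using assms by simp
  ultimately have "real y + real (x mod y) \<le> real x" and "real (x mod y) \<le> real y"
    by linarith+
  \<comment> \<open>With r = \<open>x mod y\<close>, the difference of the two sides is at least (y
    - r) / 2.\<close>
  then show ?thesis
    by simp
qed

text \<open>Exponential form, so that the induction avoids logarithms. The factor
  \<open>3 / 2\<close> on the right pays for the final call, which shrinks nothing.\<close>

lemma power_euclid_iterations_le:
  assumes "x > y"
  shows "(3 / 2) ^ euclid_iterations x y \<le> 3 / 2 * real (x + y)"
  using assms
proof (induction y arbitrary: x rule: less_induct)
  case (less y)
  show ?case
  proof (cases "y \<le> 1")
    case True
    then have "euclid_iterations x y = 1"
      by (simp add: euclid_iterations_rec [of x y])
    \<comment> \<open>Suffices since \<open>x > y\<close> gives x + y \<ge> 1.\<close>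
    then show ?thesis
      using less.prems by simp
  next
    case False
    then have "x mod y < y"
      by simp
    then have "(3 / 2) ^ euclid_iterations y (x mod y) \<le> 3 / 2 * real (y + x mod y)"
      using less.IH by blast
    also have "\<dots> \<le> real (x + y)"
      using False less.prems by (intro sum_mod_le) auto
    finally show ?thesis
      using False by (simp add: euclid_iterations_rec [of x y])
  qed
qed

theorem theorem1:
  fixes x y :: nat
  assumes "x > y" and "y \<ge> 0"
  shows "real (euclid_iterations x y) \<le> log (3 / 2) (real (x + y)) + 1"
proof -
  have "real (euclid_iterations x y) \<le> log (3 / 2) (3 / 2 * real (x + y))"
    using power_euclid_iterations_le [OF assms(1)] assms(1)
    by (intro le_log_of_power) simp_all
  \<comment> \<open>The factor for the final call becomes the summand 1.\<close>
  also have "\<dots> = log (3 / 2) (real (x + y)) + 1"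
    using assms(1) by (subst log_mult) simp_all
  finally show ?thesis .
qed

end
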